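(* Let $q\ge 2$ be an integer. For integers $m\ge n$ let $$p_{m,n}(r)=r^m-q\,r^{m-1}+q^{m-n}.$$ If $n\geq 2$ and $n\le m< (n-1)+\dfrac{(n-1)\ln(q-1)}{\ln(q)-\ln(q-1)}$, then the polynomial $p_{m,n}$ has a simple positive real root $\mu_{m,n}$, and all the other (complex) roots of $p_{m,n}$ have modulus less than $\mu_{m,n}$.
   Context: Here $q$ is the number of symbols in the alphabet $\Lambda=\{0,1,\dots,q-1\}$; no further definitions are needed. *)

theory Defs
  imports "HOL-Analysis.Analysis" "HOL-Computational_Algebra.Computational_Algebra"
begin

text \<open>
  The exponents use truncated subtraction on \<^typ>\<open>nat\<close>; they are the intended ones
  whenever \<open>1 \<le> m\<close> and \<open>n \<le> m\<close>.
\<close>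

definition p_poly :: "nat \<Rightarrow> nat \<Rightarrow> nat \<Rightarrow> complex poly" where
  "p_poly q m n = monom 1 m - monom (of_nat q) (m - 1) + [:of_nat q ^ (m - n):]"

end

theory Submission
  imports Defs
begin

text \<open>
  Put \<open>k = m - 1\<close> and \<open>c = q ^ (m - n)\<close>. The roots of the polynomial are the solutions of
  \<open>z ^ k * (q - z) = c\<close>, and everything depends on the real function
  \<open>f r = r ^ k * (q - r)\<close>, which on the positive half-line attains its maximum at the critical
  point \<open>k * q / (k + 1)\<close>.

  \<^item> After clearing denominators and exponentiating, the hypothesis on \<open>m\<close> says
    \<open>q ^ (m - n + 1) < (q - 1) ^ m\<close>, which gives \<open>c < (q - 1) ^ k = f (q - 1)\<close>
    (lemma \<open>constant_term_bound\<close>).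

  \<^item> Hence \<open>c\<close> lies below the maximum of \<open>f\<close>, and as \<open>f q = 0 < c\<close>, the equation \<open>f \<mu> = c\<close> has
    a solution \<open>\<mu>\<close> strictly between the critical point and \<open>q\<close>
    (lemma \<open>root_beyond_critical_point\<close>). The strict inequality \<open>k * (q - \<mu>) < \<mu>\<close> says that the
    derivative does not vanish at \<open>\<mu>\<close>, so the root is simple.

  \<^item> The same inequality makes \<open>\<mu>\<close> dominant (lemma \<open>root_dominant\<close>): dividing the polynomial by
    \<open>z - \<mu>\<close> shows that any other root satisfies
    \<open>z ^ k = (q - \<mu>) * (\<Sum>i<k. \<mu> ^ (k - 1 - i) * z ^ i)\<close>. If \<open>\<bar>z\<bar> \<ge> \<mu>\<close>, each of the \<open>k\<close> summands
    has modulus at most \<open>\<bar>z\<bar> ^ (k - 1)\<close>, so \<open>\<bar>z\<bar> \<le> k * (q - \<mu>) < \<mu>\<close>, a contradiction.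
\<close>

text \<open>
  By Bernoulli's inequality for the ratio of the critical point to \<open>r\<close>, the difference of the two
  sides is bounded below by a positive multiple of the square of the distance from \<open>r\<close> to the
  critical point.
\<close>

lemma critical_point_maximal:
  fixes a r :: real and k :: nat
  assumes "0 < r" "0 < a"
  defines "s \<equiv> real k * a / (real k + 1)"
  shows "r ^ k * (a - r) \<le> s ^ k * (a - s)"
proof -
  have s0: "0 \<le> s" using assms by (simp add: s_def)
  have as: "a - s = a / (real k + 1)" by (simp add: s_def field_simps)
  have "1 + real k * (s / r - 1) \<le> (1 + (s / r - 1)) ^ k"
    by (rule Bernoulli_inequality) (use s0 \<open>0 < r\<close> in simp)
  then have bernoulli: "1 + real k * (s / r - 1) \<le> (s / r) ^ k" by simp
  have ka: "real k * (a - s) = s" unfolding as by (simp add: s_def)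
  have "r * ((1 + real k * (s / r - 1)) * (a - s) - (a - r))
        = (a - s) * r + real k * (a - s) * (s - r) - r * (a - r)"
    using \<open>0 < r\<close> by (simp add: field_simps)
  also have "\<dots> = (r - s)\<^sup>2"
    unfolding ka by (simp add: power2_eq_square algebra_simps)
  finally have "0 \<le> r * ((1 + real k * (s / r - 1)) * (a - s) - (a - r))" by simp
  then have "a - r \<le> (1 + real k * (s / r - 1)) * (a - s)"
    using \<open>0 < r\<close> by (simp add: zero_le_mult_iff)
  also have "\<dots> \<le> (s / r) ^ k * (a - s)"
    by (rule mult_right_mono[OF bernoulli]) (use as \<open>0 < a\<close> in simp)
  finally have "r ^ k * (a - r) \<le> r ^ k * ((s / r) ^ k * (a - s))"
    using \<open>0 < r\<close> by (intro mult_left_mono) auto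
  also have "\<dots> = s ^ k * (a - s)"
    using \<open>0 < r\<close> by (simp add: power_divide)
  finally show ?thesis .
qed

text \<open>
  The condition \<open>real k * (a - \<mu>) < \<mu>\<close> places \<open>\<mu>\<close> to the right of the critical point; it is the
  form in which both simplicity and dominance use it.
\<close>

lemma root_beyond_critical_point:
  fixes a r c :: real and k :: nat
  assumes "0 < r" "0 < a" "0 < c" and below: "c < r ^ k * (a - r)"
  obtains \<mu> where "0 < \<mu>" "\<mu> \<le> a" "real k * (a - \<mu>) < \<mu>" "\<mu> ^ k * (a - \<mu>) = c"
proof -
  define s where "s = real k * a / (real k + 1)"
  have "r ^ k * (a - r) \<le> s ^ k * (a - s)"
    unfolding s_def by (rule critical_point_maximal[OF assms(1,2)])
  with below have cs: "c < s ^ k * (a - s)" by simp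
  have "s \<le> a" using \<open>0 < a\<close> by (simp add: s_def field_simps)
  have "\<exists>\<mu>\<ge>s. \<mu> \<le> a \<and> \<mu> ^ k * (a - \<mu>) = c"
    by (rule IVT2') (use cs \<open>0 < c\<close> \<open>s \<le> a\<close> in \<open>auto intro!: continuous_intros\<close>)
  then obtain \<mu> where \<mu>: "s \<le> \<mu>" "\<mu> \<le> a" "\<mu> ^ k * (a - \<mu>) = c" by blast
  have "\<mu> \<noteq> s" using cs \<mu>(3) by auto
  then have "s < \<mu>" using \<mu>(1) by simp
  moreover have "0 \<le> s" using \<open>0 < a\<close> by (simp add: s_def)
  moreover have "real k * (a - \<mu>) < \<mu>"
    using \<open>s < \<mu>\<close> by (simp add: s_def field_simps)
  ultimately show thesis using that[of \<mu>] \<mu> by simp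
qed

lemma root_dominant:
  fixes a \<mu> :: real and z :: complex and k :: nat
  assumes "0 < \<mu>" "\<mu> \<le> a" and beyond: "real k * (a - \<mu>) < \<mu>"
    and root: "z ^ k * (of_real a - z) = of_real (\<mu> ^ k * (a - \<mu>))"
    and "z \<noteq> of_real \<mu>" and "k \<noteq> 0"
  shows "cmod z < \<mu>"
proof (rule ccontr)
  assume "\<not> cmod z < \<mu>"
  then have ge: "\<mu> \<le> cmod z" by simp
  let ?S = "\<Sum>i<k. of_real \<mu> ^ (k - Suc i) * z ^ i"
  have "(z - of_real \<mu>) * z ^ k = of_real (a - \<mu>) * (z ^ k - of_real \<mu> ^ k)"
    using root by (simp add: algebra_simps)
  also have "\<dots> = (z - of_real \<mu>) * (of_real (a - \<mu>) * ?S)"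
    by (simp only: power_diff_sumr2[of z k "of_real \<mu>"] mult.left_commute)
  finally have cofactor: "z ^ k = of_real (a - \<mu>) * ?S"
    using \<open>z \<noteq> of_real \<mu>\<close> by simp
  have "cmod ?S \<le> (\<Sum>i<k. cmod z ^ (k - 1))"
  proof (rule sum_norm_le)
    fix i assume "i \<in> {..<k}"
    then have split: "k - 1 = (k - Suc i) + i" by simp
    have "\<mu> ^ (k - Suc i) \<le> cmod z ^ (k - Suc i)"
      using ge \<open>0 < \<mu>\<close> by (intro power_mono) auto
    then have "\<mu> ^ (k - Suc i) * cmod z ^ i \<le> cmod z ^ (k - Suc i) * cmod z ^ i"
      by (rule mult_right_mono) simp
    then show "cmod (of_real \<mu> ^ (k - Suc i) * z ^ i) \<le> cmod z ^ (k - 1)"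
      unfolding split power_add using \<open>0 < \<mu>\<close> by (simp add: norm_mult norm_power)
  qed
  then have "(a - \<mu>) * cmod ?S \<le> (a - \<mu>) * (real k * cmod z ^ (k - 1))"
    using \<open>\<mu> \<le> a\<close> by (intro mult_left_mono) auto
  moreover have "cmod z ^ k = (a - \<mu>) * cmod ?S"
    using arg_cong[OF cofactor, of cmod] \<open>\<mu> \<le> a\<close>
    by (simp only: norm_mult norm_power norm_of_real)
  ultimately have "cmod z * cmod z ^ (k - 1) \<le> real k * (a - \<mu>) * cmod z ^ (k - 1)"
    using \<open>k \<noteq> 0\<close> by (simp add: power_eq_if mult_ac)
  moreover have "0 < cmod z ^ (k - 1)"
    using ge \<open>0 < \<mu>\<close> by (intro zero_less_power) linarith
  ultimately have "cmod z \<le> real k * (a - \<mu>)" by simp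
  with ge beyond show False by linarith
qed

lemma constant_term_bound:
  fixes q m n :: nat
  assumes "q \<ge> 2" and "n \<ge> 2" and "n \<le> m"
    and bound: "real m < (real n - 1)
      + (real n - 1) * ln (real q - 1) / (ln (real q) - ln (real q - 1))"
  shows "real q ^ (m - n) < (real q - 1) ^ (m - 1)"
proof -
  have "0 < ln (real q) - ln (real q - 1)" using \<open>q \<ge> 2\<close> by simp
  with bound have "real m * (ln (real q) - ln (real q - 1)) < (real n - 1) * ln (real q)"
    by (simp add: field_simps)
  then have "(real m - real n + 1) * ln (real q) < real m * ln (real q - 1)"
    by (simp add: algebra_simps)
  moreover have "real (Suc (m - n)) = real m - real n + 1"
    using \<open>n \<le> m\<close> by (simp add: of_nat_diff)
  ultimately have "ln (real q ^ Suc (m - n)) < ln ((real q - 1) ^ m)"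
    using \<open>q \<ge> 2\<close> by (simp only: ln_realpow)
  then have "real q * real q ^ (m - n) < (real q - 1) ^ m"
    using \<open>q \<ge> 2\<close> by simp
  also have "\<dots> = (real q - 1) * (real q - 1) ^ (m - 1)"
    using \<open>n \<ge> 2\<close> \<open>n \<le> m\<close> by (simp add: power_eq_if)
  also have "\<dots> \<le> real q * (real q - 1) ^ (m - 1)"
    using \<open>q \<ge> 2\<close> by (intro mult_right_mono) auto
  finally show ?thesis using \<open>q \<ge> 2\<close> by simp
qed

lemma poly_p_poly_eq_0_iff:
  assumes "m \<ge> 1"
  shows "poly (p_poly q m n) z = 0 \<longleftrightarrow> z ^ (m - 1) * (of_nat q - z) = of_nat q ^ (m - n)"
proof -
  have "z ^ m = z * z ^ (m - 1)" using assms by (simp add: power_eq_if)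
  then show ?thesis
    by (auto simp: p_poly_def poly_monom algebra_simps)
qed

lemma poly_pderiv_p_poly:
  assumes "m \<ge> 2"
  shows "poly (pderiv (p_poly q m n)) z = z ^ (m - 2) * (z - of_nat (m - 1) * (of_nat q - z))"
proof -
  obtain j where "m = Suc (Suc j)" using assms by (metis add_2_eq_Suc le_Suc_ex)
  then show ?thesis
    by (simp add: p_poly_def pderiv_add pderiv_diff pderiv_monom pderiv_pCons poly_monom
        algebra_simps)
qed

theorem theorem5p2:
  fixes q m n :: nat
  assumes "q \<ge> 2" and "n \<ge> 2" and "n \<le> m"
    and "real m < (real n - 1) + (real n - 1) * ln (real q - 1) / (ln (real q) - ln (real q - 1))"
  shows "\<exists>\<mu>::real. \<mu> > 0 \<and> order (of_real \<mu>) (p_poly q m n) = 1 \<and>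
           (\<forall>z::complex. poly (p_poly q m n) z = 0 \<and> z \<noteq> of_real \<mu> \<longrightarrow> cmod z < \<mu>)"
proof -
  let ?p = "p_poly q m n"
  have "m \<ge> 2" using assms by simp
  have below: "real q ^ (m - n) < (real q - 1) ^ (m - 1) * (real q - (real q - 1))"
    using constant_term_bound[OF assms] by simp
  obtain \<mu> where \<mu>: "0 < \<mu>" "\<mu> \<le> real q" "real (m - 1) * (real q - \<mu>) < \<mu>"
      and eq: "\<mu> ^ (m - 1) * (real q - \<mu>) = real q ^ (m - n)"
    by (rule root_beyond_critical_point[OF _ _ _ below]) (use \<open>q \<ge> 2\<close> in auto)
  have root_iff: "poly ?p z = 0 \<longleftrightarrow>
      z ^ (m - 1) * (of_real (real q) - z) = of_real (\<mu> ^ (m - 1) * (real q - \<mu>))" for z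
    using \<open>m \<ge> 2\<close> unfolding eq by (simp add: poly_p_poly_eq_0_iff)
  have "poly ?p (of_real \<mu>) = 0" by (simp add: root_iff)
  have "poly (pderiv ?p) (of_real \<mu>)
      = of_real (\<mu> ^ (m - 2) * (\<mu> - real (m - 1) * (real q - \<mu>)))"
    by (simp add: poly_pderiv_p_poly[OF \<open>m \<ge> 2\<close>])
  then have deriv: "poly (pderiv ?p) (of_real \<mu>) \<noteq> 0"
    using \<mu> by (simp only: of_real_eq_0_iff) simp
  then have "?p \<noteq> 0" by auto
  then have "order (of_real \<mu>) ?p = Suc (order (of_real \<mu>) (pderiv ?p))"
    using \<open>poly ?p (of_real \<mu>) = 0\<close> by (rule order_pderiv)
  also have "order (of_real \<mu>) (pderiv ?p) = 0" using deriv by (rule order_0I)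
  finally have "order (of_real \<mu>) ?p = 1" by simp
  moreover have "cmod z < \<mu>" if "poly ?p z = 0" "z \<noteq> of_real \<mu>" for z
    using root_dominant[OF \<mu> _ that(2)] that(1) \<open>m \<ge> 2\<close> by (simp add: root_iff)
  ultimately show ?thesis using \<mu>(1) by blast
qed

end
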